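(* Let $G=(V,E)$ be a global amoeba with $k$ vertices, $m$ edges and degree sequence $d_1\ge\cdots\ge d_k$. For any integer $\ell\ge 1$ satisfying $\sum_{i=1}^{\ell} d_i<\left\lfloor \frac m2\right\rfloor$, we have, for all sufficiently large $n$, $\mathrm{bal}(n,G)\ge \ell(n-\ell)$. In particular, for all sufficiently large $n$, $$\mathrm{bal}(n,G)\ge \left\lfloor\frac{m-1}{2k+1}\right\rfloor\left(n-\left\lfloor\frac{m-1}{2k+1}\right\rfloor\right).$$
   Context: Graphs are finite and simple; $e(G)$ is the number of edges of $G$. In a 2-edge-coloring of $K_n$, a copy of $G$ is balanced if it has $\lfloor e(G)/2\rfloor$ edges in one of the colors and $\lceil e(G)/2\rceil$ in the other. The balancing number $\mathrm{bal}(n,G)$ is the smallest integer $t\ge 0$ such that every 2-edge-coloring of $K_n$ with more than $t$ edges in each color contains a balanced copy of $G$. Global amoeba: $S_X$ is the symmetric group on a finite set $X$. A labeling of a graph $F$ with vertex set $V$ is a bijection $\lambda:V\to X$; write $v_x=\lambda^{-1}(x)$ and $L_F=\{ij : v_iv_j\in E(F)\}$. For $\sigma\in S_X$, $F_\sigma$ is the graph on $V$ with edge set $\{v_iv_j : \sigma(i)\sigma(j)\in L_F\}$. A feasible edge-replacement $rs\to pq$ is given by an edge $v_rv_s\in E(F)$ and a non-edge $v_pv_q\in E(\overline F)$ with $F-v_rv_s+v_pv_q\cong F$; the neutral replacement $\emptyset\to\emptyset$ is also feasible. Put $\mathrm{Fer}_F(rs\to pq)=\{\sigma\in S_X : F_\sigma=F-v_rv_s+v_pv_q\}$,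 $\mathrm{Fer}_F(\emptyset\to\emptyset)=\{\sigma : F_\sigma=F\}$, and let $\mathrm{Fer}(F)\le S_X$ be the group generated by the union of these sets over all feasible edge-replacements. A graph $G$ of order $N$ is a global amoeba if $\mathrm{Fer}(G\cup K_1)\cong S_{N+1}$, where $G\cup K_1$ is $G$ plus an isolated vertex. (Equivalently, for $n$ large enough, any copy of $G$ in $K_n$ can be transformed into any other copy of $G$ in $K_n$ by a chain of feasible edge-replacements.) *)

theory Defs
  imports Complex_Main "HOL-Library.Ramsey" "HOL-Library.Multiset" "HOL-Algebra.Sym_Groups"
begin

section \<open>Finite simple graphs\<close>

record 'a ugraph =
  verts :: "'a set"
  edges :: "'a set set"

definition simple_graph :: "'a ugraph \<Rightarrow> bool" where
  "simple_graph G \<longleftrightarrow> finite (verts G) \<and> edges G \<subseteq> nsets (verts G) 2"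

definition graph_iso :: "'a ugraph \<Rightarrow> 'b ugraph \<Rightarrow> bool" where
  "graph_iso G H \<longleftrightarrow>
     (\<exists>f. bij_betw f (verts G) (verts H) \<and>
          (\<forall>u\<in>verts G. \<forall>v\<in>verts G. {u, v} \<in> edges G \<longleftrightarrow> {f u, f v} \<in> edges H))"

definition subgraph :: "'a ugraph \<Rightarrow> 'a ugraph \<Rightarrow> bool" where
  "subgraph H G \<longleftrightarrow> simple_graph H \<and> verts H \<subseteq> verts G \<and> edges H \<subseteq> edges G"

definition complete_graph :: "nat \<Rightarrow> nat ugraph" where
  "complete_graph n = \<lparr>verts = {..<n}, edges = nsets {..<n} 2\<rparr>"

definition degree :: "'a ugraph \<Rightarrow> 'a \<Rightarrow> nat" where
  "degree G v = card {e \<in> edges G. v \<in> e}"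

definition degree_sequence :: "'a ugraph \<Rightarrow> nat list" where
  "degree_sequence G = rev (sorted_list_of_multiset (image_mset (degree G) (mset_set (verts G))))"

text \<open>The graph obtained from \<open>G\<close> by adding one isolated vertex, namely \<open>None\<close>.\<close>

definition add_isolated :: "'a ugraph \<Rightarrow> 'a option ugraph" where
  "add_isolated G = \<lparr>verts = insert None (Some ` verts G), edges = (\<lambda>e. Some ` e) ` edges G\<rparr>"

section \<open>Balancing number\<close>

text \<open>A 2-edge-coloring of the complete graph is a function on vertex sets, of which only the
  values on edges matter; the two colors are \<open>True\<close> and \<open>False\<close>.\<close>

definition color_class :: "(nat set \<Rightarrow> bool) \<Rightarrow> bool \<Rightarrow> nat ugraph \<Rightarrow> nat set set" where
  "color_class c b H = {e \<in> edges H. c e = b}"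

definition balanced :: "(nat set \<Rightarrow> bool) \<Rightarrow> nat ugraph \<Rightarrow> bool" where
  "balanced c H \<longleftrightarrow>
     (\<exists>b. card (color_class c b H) = card (edges H) div 2 \<and>
          card (color_class c (\<not> b) H) = (card (edges H) + 1) div 2)"

definition has_balanced_copy :: "nat \<Rightarrow> (nat set \<Rightarrow> bool) \<Rightarrow> 'a ugraph \<Rightarrow> bool" where
  "has_balanced_copy n c G \<longleftrightarrow>
     (\<exists>H. subgraph H (complete_graph n) \<and> graph_iso G H \<and> balanced c H)"

definition bal :: "nat \<Rightarrow> 'a ugraph \<Rightarrow> nat" where
  "bal n G = (LEAST t. \<forall>c.
     t < card (color_class c True (complete_graph n)) \<and>
     t < card (color_class c False (complete_graph n)) \<longrightarrow> has_balanced_copy n c G)"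

section \<open>Global amoebas\<close>

text \<open>Labels are taken from \<open>{1..N}\<close>, where \<open>N\<close> is the order of the graph, so that the symmetric
  group on the label set is \<open>sym_group N\<close>.\<close>

definition labeling :: "'a ugraph \<Rightarrow> ('a \<Rightarrow> nat) \<Rightarrow> bool" where
  "labeling F lab \<longleftrightarrow> bij_betw lab (verts F) {1..card (verts F)}"

definition vert :: "'a ugraph \<Rightarrow> ('a \<Rightarrow> nat) \<Rightarrow> nat \<Rightarrow> 'a" where
  "vert F lab = inv_into (verts F) lab"

definition label_edges :: "'a ugraph \<Rightarrow> ('a \<Rightarrow> nat) \<Rightarrow> nat set set" where
  "label_edges F lab = {{i, j} | i j.
     i \<in> {1..card (verts F)} \<and> j \<in> {1..card (verts F)} \<and> {vert F lab i, vert F lab j} \<in> edges F}"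

definition permuted_graph :: "'a ugraph \<Rightarrow> ('a \<Rightarrow> nat) \<Rightarrow> (nat \<Rightarrow> nat) \<Rightarrow> 'a ugraph" where
  "permuted_graph F lab \<sigma> = \<lparr>verts = verts F, edges = {{vert F lab i, vert F lab j} | i j.
     i \<in> {1..card (verts F)} \<and> j \<in> {1..card (verts F)} \<and> {\<sigma> i, \<sigma> j} \<in> label_edges F lab}\<rparr>"

definition replace_edge :: "'a ugraph \<Rightarrow> 'a set \<Rightarrow> 'a set \<Rightarrow> 'a ugraph" where
  "replace_edge F e f = \<lparr>verts = verts F, edges = (edges F - {e}) \<union> {f}\<rparr>"

definition feasible_replacement :: "'a ugraph \<Rightarrow> 'a set \<Rightarrow> 'a set \<Rightarrow> bool" where
  "feasible_replacement F e f \<longleftrightarrow>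
     e \<in> edges F \<and> f \<in> nsets (verts F) 2 - edges F \<and> graph_iso (replace_edge F e f) F"

definition Fer_replacement ::
    "'a ugraph \<Rightarrow> ('a \<Rightarrow> nat) \<Rightarrow> 'a set \<Rightarrow> 'a set \<Rightarrow> (nat \<Rightarrow> nat) set" where
  "Fer_replacement F lab e f =
     {\<sigma> \<in> carrier (sym_group (card (verts F))). permuted_graph F lab \<sigma> = replace_edge F e f}"

definition Fer_neutral :: "'a ugraph \<Rightarrow> ('a \<Rightarrow> nat) \<Rightarrow> (nat \<Rightarrow> nat) set" where
  "Fer_neutral F lab = {\<sigma> \<in> carrier (sym_group (card (verts F))). permuted_graph F lab \<sigma> = F}"

definition Fer :: "'a ugraph \<Rightarrow> ('a \<Rightarrow> nat) \<Rightarrow> (nat \<Rightarrow> nat) monoid" where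
  "Fer F lab = (sym_group (card (verts F)))\<lparr>carrier :=
     generate (sym_group (card (verts F)))
       (Fer_neutral F lab \<union>
        \<Union> {Fer_replacement F lab e f | e f. feasible_replacement F e f})\<rparr>"

text \<open>Changing the labeling conjugates \<open>Fer\<close> inside the symmetric group, so it is immaterial
  which labeling is used.\<close>

definition global_amoeba :: "'a ugraph \<Rightarrow> bool" where
  "global_amoeba G \<longleftrightarrow>
     (\<exists>lab. labeling (add_isolated G) lab \<and>
            Fer (add_isolated G) lab \<cong> sym_group (card (verts G) + 1))"

end

theory Submission
  imports Defs
begin

text \<open>Fix a set \<open>A\<close> of \<open>l\<close> vertices of \<open>K\<^sub>n\<close> and give one color to the edges that meet \<open>A\<close>
  and the other color to the edges that avoid \<open>A\<close>. The first class contains the \<open>l * (n - l)\<close>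
  edges between \<open>A\<close> and its complement, and the second has quadratic size, so for large \<open>n\<close>
  both have at least \<open>l * (n - l)\<close> edges
  (lemmas \<open>card_edges_meeting\<close> and \<open>card_edges_avoiding\<close>). In a copy of \<open>G\<close>, however, the edges
  meeting \<open>A\<close> are covered by at most \<open>l\<close> vertices, so there are at most
  \<open>d\<^sub>1 + \<dots> + d\<^sub>l\<close> of them (\<open>edges_meeting_copy_le\<close>). If this is less than
  \<open>m div 2\<close>, no copy is balanced. Hence no \<open>t < l * (n - l)\<close> has the property whose least
  instance is \<open>bal n G\<close>; some \<open>t\<close> does have it, because for \<open>t\<close> at least the number of edges of
  \<open>K\<^sub>n\<close> there is no coloring to consider.

  The explicit bound is the case \<open>l = (m - 1) div (2 * k + 1)\<close>: every degree is less than \<open>k\<close>, so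
  the \<open>l\<close> largest degrees have sum at most \<open>l * k\<close>, and \<open>2 * l * k + l \<le> m - 1\<close>.\<close>

section \<open>Sums of the largest entries of a list\<close>

text \<open>Exchange argument: an entry of \<open>B\<close> can be traded for the head of the list, which is at least
  as large. Multisets keep track of repeated values.\<close>

lemma sum_mset_le_sum_list_take:
  fixes xs :: "nat list"
  assumes "sorted_wrt (\<ge>) xs" "B \<subseteq># mset xs" "size B \<le> l"
  shows "sum_mset B \<le> sum_list (take l xs)"
  using assms
proof (induction xs arbitrary: B l)
  case Nil
  then show ?case by simp
next
  case (Cons x xs)
  show ?case
  proof (cases "B = {#}")
    case True
    then show ?thesis by simp
  next
    case False
    then obtain l' where l: "l = Suc l'"
      using Cons.prems(3) by (cases l) auto
    obtain y where y: "y \<in># B" "y \<le> x" "B - {#y#} \<subseteq># mset xs"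
    proof (cases "x \<in># B")
      case True
      then show ?thesis
        using that[of x] Cons.prems(2) by (simp add: subset_eq_diff_conv)
    next
      case x: False
      from False obtain y where y: "y \<in># B" by blast
      have "B \<subseteq># mset xs"
        unfolding subseteq_mset_def
      proof
        fix a
        have "count B a \<le> count (mset (x # xs)) a"
          using Cons.prems(2) by (rule mset_subset_eq_count)
        then show "count B a \<le> count (mset xs) a"
          using x by (cases "a = x") (auto simp: not_in_iff)
      qed
      then have "y \<in> set xs" "B - {#y#} \<subseteq># mset xs"
        using y by (auto dest: mset_subset_eqD intro: subset_mset.order_trans[OF diff_subset_eq_self])
      then show ?thesis
        using that[of y] y Cons.prems(1) by auto
    qed
    have "sum_mset (B - {#y#}) \<le> sum_list (take l' xs)"
      using Cons.IH[of "B - {#y#}" l'] Cons.prems y l by (auto simp: size_Diff_singleton)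
    moreover have "sum_mset B = y + sum_mset (B - {#y#})"
      using y(1) by (metis insert_DiffM sum_mset.add_mset)
    ultimately show ?thesis
      using y(2) l by simp
  qed
qed

lemma sum_degree_le_take_degree_sequence:
  assumes "finite (verts G)" "S \<subseteq> verts G" "card S \<le> l"
  shows "(\<Sum>v\<in>S. degree G v) \<le> sum_list (take l (degree_sequence G))"
proof -
  have fin: "finite S" using assms finite_subset by blast
  have "sorted_wrt (\<ge>) (degree_sequence G)"
    unfolding degree_sequence_def sorted_wrt_rev by simp
  moreover have "image_mset (degree G) (mset_set S) \<subseteq># mset (degree_sequence G)"
    using assms by (simp add: degree_sequence_def image_mset_subseteq_mono subset_imp_msubset_mset_set)
  ultimately have "sum_mset (image_mset (degree G) (mset_set S))
      \<le> sum_list (take l (degree_sequence G))"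
    using assms fin by (intro sum_mset_le_sum_list_take) auto
  then show ?thesis
    by (simp add: sum_unfold_sum_mset)
qed

section \<open>Edges and degrees of simple graphs and of their copies\<close>

lemma simple_graph_edge_subset:
  assumes "simple_graph G" "e \<in> edges G"
  shows "e \<subseteq> verts G"
  using assms by (auto simp: simple_graph_def nsets_def)

lemma finite_edges:
  assumes "simple_graph G"
  shows "finite (edges G)"
  using assms simple_graph_edge_subset[OF assms]
  by (meson Pow_iff finite_Pow_iff finite_subset simple_graph_def subsetI)

lemma degree_less_card_verts:
  assumes "simple_graph G" "v \<in> verts G"
  shows "degree G v < card (verts G)"
proof -
  have fin: "finite (verts G)" using assms(1) by (simp add: simple_graph_def)
  have "{e \<in> edges G. v \<in> e} \<subseteq> (\<lambda>u. {u, v}) ` (verts G - {v})"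
  proof
    fix e assume e: "e \<in> {e \<in> edges G. v \<in> e}"
    then have "e \<in> nsets (verts G) 2" using assms(1) by (auto simp: simple_graph_def)
    then obtain a b where "e = {a, b}" "a \<noteq> b" "a \<in> verts G" "b \<in> verts G"
      by (auto simp: nsets_def card_2_iff)
    then show "e \<in> (\<lambda>u. {u, v}) ` (verts G - {v})"
      using e by auto
  qed
  then have "degree G v \<le> card (verts G - {v})"
    unfolding degree_def using fin by (meson finite_Diff surj_card_le)
  also have "\<dots> < card (verts G)"
    using assms(2) fin by (intro card_Diff1_less)
  finally show ?thesis .
qed

lemma iso_edges_image:
  assumes G: "simple_graph G" and H: "simple_graph H"
    and f: "bij_betw f (verts G) (verts H)"
    and iso: "\<And>u v. u \<in> verts G \<Longrightarrow> v \<in> verts G \<Longrightarrow> {u, v} \<in> edges G \<longleftrightarrow> {f u, f v} \<in> edges H"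
  shows "edges H = (`) f ` edges G"
proof (intro subset_antisym subsetI)
  fix e assume e: "e \<in> edges H"
  then have "e \<in> nsets (verts H) 2" using H by (auto simp: simple_graph_def)
  then obtain a b where ab: "e = {a, b}" "a \<in> verts H" "b \<in> verts H"
    by (auto simp: nsets_def card_2_iff)
  then obtain u v where uv: "u \<in> verts G" "v \<in> verts G" "a = f u" "b = f v"
    using f unfolding bij_betw_def by blast
  then have "{u, v} \<in> edges G" using iso e ab by simp
  moreover have "e = f ` {u, v}" using ab uv by simp
  ultimately show "e \<in> (`) f ` edges G" by blast
next
  fix e assume "e \<in> (`) f ` edges G"
  then obtain e' where e': "e' \<in> edges G" "e = f ` e'" by blast
  then have "e' \<in> nsets (verts G) 2" using G by (auto simp: simple_graph_def)
  then obtain u v where "e' = {u, v}" "u \<in> verts G" "v \<in> verts G"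
    by (auto simp: nsets_def card_2_iff)
  then show "e \<in> edges H" using iso e' by simp
qed

lemma inj_on_image_edges:
  assumes "simple_graph G" "bij_betw f (verts G) V"
  shows "inj_on ((`) f) (edges G)"
proof (rule inj_on_subset)
  show "inj_on ((`) f) (Pow (verts G))"
    using assms by (auto simp: bij_betw_def intro: inj_on_image_Pow)
  show "edges G \<subseteq> Pow (verts G)"
    using simple_graph_edge_subset[OF assms(1)] by blast
qed

lemma iso_card_edges:
  assumes "simple_graph G" "simple_graph H" "graph_iso G H"
  shows "card (edges H) = card (edges G)"
proof -
  obtain f where f: "bij_betw f (verts G) (verts H)"
    "\<And>u v. u \<in> verts G \<Longrightarrow> v \<in> verts G \<Longrightarrow> {u, v} \<in> edges G \<longleftrightarrow> {f u, f v} \<in> edges H"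
    using assms(3) unfolding graph_iso_def by blast
  show ?thesis
    using iso_edges_image[OF assms(1,2) f] inj_on_image_edges[OF assms(1) f(1)]
    by (simp add: card_image)
qed

text \<open>In the copy \<open>H\<close>, an edge that meets \<open>A\<close> is incident with a vertex of \<open>A \<inter> verts H\<close>, so the
  degrees of these vertices bound the number of such edges. These degrees are degrees of
  \<open>G\<close> at distinct vertices.\<close>

lemma edges_meeting_copy_le:
  assumes G: "simple_graph G" and H: "simple_graph H" and "graph_iso G H"
    and A: "finite A" "card A \<le> l"
  shows "card {e \<in> edges H. e \<inter> A \<noteq> {}} \<le> sum_list (take l (degree_sequence G))"
proof -
  obtain f where f: "bij_betw f (verts G) (verts H)"
    "\<And>u v. u \<in> verts G \<Longrightarrow> v \<in> verts G \<Longrightarrow> {u, v} \<in> edges G \<longleftrightarrow> {f u, f v} \<in> edges H"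
    using assms(3) unfolding graph_iso_def by blast
  have inj: "inj_on f (verts G)" using f(1) by (simp add: bij_betw_def)
  define S where "S = {v \<in> verts G. f v \<in> A}"
  have fin: "finite (verts G)" using G by (simp add: simple_graph_def)
  have S: "S \<subseteq> verts G" "finite S" using fin by (auto simp: S_def)
  have "card S = card (f ` S)"
    using inj S(1) by (metis card_image inj_on_subset)
  also have "\<dots> \<le> card A"
    using A by (intro card_mono) (auto simp: S_def)
  finally have card_S: "card S \<le> l" using A by simp
  have "{e \<in> edges H. e \<inter> A \<noteq> {}} \<subseteq> (`) f ` (\<Union>v\<in>S. {e \<in> edges G. v \<in> e})"
  proof
    fix e assume e: "e \<in> {e \<in> edges H. e \<inter> A \<noteq> {}}"
    then obtain e' where e': "e' \<in> edges G" "e = f ` e'"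
      using iso_edges_image[OF G H f] by blast
    then obtain v where "v \<in> e'" "f v \<in> A" using e by auto
    then show "e \<in> (`) f ` (\<Union>v\<in>S. {e \<in> edges G. v \<in> e})"
      using e' simple_graph_edge_subset[OF G] by (auto simp: S_def)
  qed
  then have "card {e \<in> edges H. e \<inter> A \<noteq> {}} \<le> card (\<Union>v\<in>S. {e \<in> edges G. v \<in> e})"
    using S(2) finite_edges[OF G] by (intro surj_card_le) auto
  also have "\<dots> \<le> (\<Sum>v\<in>S. degree G v)"
    unfolding degree_def using S(2) by (rule card_UN_le)
  also have "\<dots> \<le> sum_list (take l (degree_sequence G))"
    using fin S(1) card_S by (rule sum_degree_le_take_degree_sequence)
  finally show ?thesis .
qed

section \<open>The coloring of the complete graph\<close>

definition meets_first :: "nat \<Rightarrow> nat set \<Rightarrow> bool" where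
  "meets_first l e \<longleftrightarrow> e \<inter> {..<l} \<noteq> {}"

lemma card_edges_meeting:
  "l * (n - l) \<le> card (color_class (meets_first l) True (complete_graph n))"
proof -
  let ?g = "\<lambda>(i, j). {i, j}"
  have inj: "inj_on ?g ({..<l} \<times> {l..<n})"
    by (auto simp: inj_on_def doubleton_eq_iff)
  have sub: "?g ` ({..<l} \<times> {l..<n}) \<subseteq> color_class (meets_first l) True (complete_graph n)"
    by (auto simp: color_class_def meets_first_def complete_graph_def nsets_def)
  have "finite (color_class (meets_first l) True (complete_graph n))"
    by (simp add: color_class_def complete_graph_def finite_imp_finite_nsets)
  from card_inj_on_le[OF inj sub this] show ?thesis by simp
qed

lemma card_edges_avoiding:
  assumes "3 * l + 1 \<le> n"
  shows "l * (n - l) \<le> card (color_class (meets_first l) False (complete_graph n))"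
proof -
  have "color_class (meets_first l) False (complete_graph n) = nsets {l..<n} 2"
    by (auto simp: color_class_def meets_first_def complete_graph_def nsets_def
        disjoint_iff subset_iff)
  then have eq: "card (color_class (meets_first l) False (complete_graph n)) = (n - l) choose 2"
    by (simp add: card_nsets)
  have "(2 * l) * (n - l) \<le> (n - l - 1) * (n - l)"
    using assms by (intro mult_right_mono) auto
  then have "l * (n - l) \<le> (n - l) * (n - l - 1) div 2"
    by (simp add: less_eq_div_iff_mult_less_eq mult.commute mult.left_commute)
  then show ?thesis
    by (simp add: eq choose_two)
qed

lemma no_balanced_copy:
  assumes "simple_graph G"
    and "sum_list (take l (degree_sequence G)) < card (edges G) div 2"
  shows "\<not> has_balanced_copy n (meets_first l) G"
proof
  assume "has_balanced_copy n (meets_first l) G"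
  then obtain H where H: "simple_graph H" "graph_iso G H" "balanced (meets_first l) H"
    by (auto simp: has_balanced_copy_def subgraph_def)
  have "color_class (meets_first l) True H = {e \<in> edges H. e \<inter> {..<l} \<noteq> {}}"
    by (auto simp: color_class_def meets_first_def)
  then have "card (color_class (meets_first l) True H) < card (edges H) div 2"
    using edges_meeting_copy_le[OF assms(1) H(1,2), of "{..<l}" l] assms(2)
      iso_card_edges[OF assms(1) H(1,2)] by simp
  moreover obtain b where
    "card (color_class (meets_first l) b H) = card (edges H) div 2"
    "card (color_class (meets_first l) (\<not> b) H) = (card (edges H) + 1) div 2"
    using H(3) by (auto simp: balanced_def)
  ultimately show False by (cases b) auto
qed

section \<open>Lower bounds on the balancing number\<close>

text \<open>Any single coloring without a balanced copy bounds \<open>bal\<close> from below by the size of its smaller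
  class. The least value is attained since the number of edges of \<open>K\<^sub>n\<close> satisfies the
  defining property vacuously.\<close>

lemma bal_ge_of_unbalanced_coloring:
  assumes "\<not> has_balanced_copy n c G"
    and "t \<le> card (color_class c True (complete_graph n))"
    and "t \<le> card (color_class c False (complete_graph n))"
  shows "t \<le> bal n G"
proof -
  let ?P = "\<lambda>t. \<forall>c. t < card (color_class c True (complete_graph n)) \<and>
     t < card (color_class c False (complete_graph n)) \<longrightarrow> has_balanced_copy n c G"
  have "card (color_class c True (complete_graph n)) \<le> card (edges (complete_graph n))" for c
    by (intro card_mono) (auto simp: color_class_def complete_graph_def finite_imp_finite_nsets)
  then have "?P (card (edges (complete_graph n)))"
    by (meson not_le)
  then have "?P (bal n G)"
    unfolding bal_def by (rule LeastI)
  then show ?thesis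
    using assms by (meson le_trans not_le)
qed

lemma eventually_bal_ge:
  assumes "simple_graph G"
    and "sum_list (take l (degree_sequence G)) < card (edges G) div 2"
  shows "\<forall>\<^sub>F n in sequentially. int (bal n G) \<ge> int l * (int n - int l)"
proof (rule eventually_sequentiallyI)
  fix n assume n: "3 * l + 1 \<le> n"
  have "l * (n - l) \<le> bal n G"
    using no_balanced_copy[OF assms] card_edges_meeting card_edges_avoiding[OF n]
    by (rule bal_ge_of_unbalanced_coloring)
  then have "int (l * (n - l)) \<le> int (bal n G)" by (rule of_nat_mono)
  then show "int (bal n G) \<ge> int l * (int n - int l)"
    using n by (simp add: of_nat_diff)
qed

lemma sum_take_degree_sequence_le:
  assumes "simple_graph G"
  shows "sum_list (take l (degree_sequence G)) \<le> l * card (verts G)"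
proof -
  have "x \<le> card (verts G)" if "x \<in> set (take l (degree_sequence G))" for x
  proof -
    have "x \<in> degree G ` verts G"
      using in_set_takeD[OF that] assms by (simp add: degree_sequence_def simple_graph_def)
    then show ?thesis using degree_less_card_verts[OF assms] by fastforce
  qed
  then have "sum_list (take l (degree_sequence G))
      \<le> length (take l (degree_sequence G)) * card (verts G)"
    using sum_list_mono[of "take l (degree_sequence G)" "\<lambda>x. x" "\<lambda>_. card (verts G)"]
    by (simp add: sum_list_triv)
  also have "\<dots> \<le> l * card (verts G)" by (intro mult_right_mono) auto
  finally show ?thesis .
qed

theorem theorem12:
  fixes G :: "'a ugraph" and k m :: nat and d :: "nat list"
  assumes "simple_graph G"
    and "global_amoeba G"
    and "k = card (verts G)"
    and "m = card (edges G)"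
    and "d = degree_sequence G"
  shows "(\<forall>l::nat. l \<ge> 1 \<and> sum_list (take l d) < m div 2 \<longrightarrow>
            (\<forall>\<^sub>F n in sequentially. int (bal n G) \<ge> int l * (int n - int l)))
       \<and> (\<forall>\<^sub>F n in sequentially.
            int (bal n G) \<ge> ((int m - 1) div (2 * int k + 1)) *
                              (int n - (int m - 1) div (2 * int k + 1)))"
proof (intro conjI allI impI)
  fix l :: nat
  assume "l \<ge> 1 \<and> sum_list (take l d) < m div 2"
  then show "\<forall>\<^sub>F n in sequentially. int (bal n G) \<ge> int l * (int n - int l)"
    using eventually_bal_ge assms by blast
next
  define q where "q = (int m - 1) div (2 * int k + 1)"
  have "\<forall>\<^sub>F n in sequentially. int (bal n G) \<ge> q * (int n - q)"
  proof (cases "q \<ge> 1")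
    case False
    \<comment> \<open>Here \<open>q\<close> is \<open>0\<close>, or \<open>-1\<close> if \<open>m = 0\<close>, so the bound is at most \<open>0\<close>.\<close>
    then have "q * (int n - q) \<le> 0" for n
      by (intro mult_nonpos_nonneg) auto
    then show ?thesis
      by (intro always_eventually allI) (meson of_nat_0_le_iff order_trans)
  next
    case True
    define l where "l = nat q"
    have l: "q = int l" "l \<ge> 1" using True by (auto simp: l_def)
    have "q * (2 * int k + 1) \<le> int m - 1"
      unfolding q_def using div_mult_mod_eq[of "int m - 1" "2 * int k + 1"] pos_mod_sign[of "2 * int k + 1" "int m - 1"]
      by linarith
    then have "int (2 * (l * k) + l) \<le> int m - 1"
      by (simp add: l(1) algebra_simps)
    then have "l * k < m div 2" using l(2) by linarith
    then have "sum_list (take l (degree_sequence G)) < card (edges G) div 2"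
      using sum_take_degree_sequence_le[OF assms(1), of l] assms(3,4) by simp
    from eventually_bal_ge[OF assms(1) this] show ?thesis by (simp add: l(1))
  qed
  then show "\<forall>\<^sub>F n in sequentially.
      int (bal n G) \<ge> ((int m - 1) div (2 * int k + 1)) *
                        (int n - (int m - 1) div (2 * int k + 1))"
    by (simp add: q_def)
qed

end
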